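(* There is a deterministic algorithm that, given a weighted colored tournament $T=(V,A)$ with weight function $w:A\to\mathbb{R}$ and color function $\mathrm{col}:V\to[g]$ (for some integer $g\ge 1$) such that $w$ satisfies both the probability constraints and the triangle inequality constraints, together with an integer $k$ and vectors $\bar\alpha\in[0,1]^g$, $\bar\beta\in[0,1]^g$, finds an optimal colorful bi-partition of $T$ (with respect to $k,\bar\alpha,\bar\beta$) in time $O(|A|+|V|\log|V|)$.
   Context: A weighted tournament $T=(V,A)$ is a directed graph in which for every pair of distinct vertices $u,v$ both arcs $(u,v)$ and $(v,u)$ are present, with non-negative weights $w$. Probability constraints: $w(i,j)+w(j,i)=1$ for all distinct $i,j\in V$. Triangle inequality constraints: $w(i,j)\le w(i,k)+w(k,j)$ for all $i,j,k\in V$. For a color function $\mathrm{col}:V\to[g]$ and $\bar\alpha=(\alpha_1,\dots,\alpha_g),\bar\beta=(\beta_1,\dots,\beta_g)\in[0,1]^g$, a set $S\subseteq V$ is $(\bar\alpha,\bar\beta)$-colorful if for every $i\in[g]$, $\lfloor\alpha_i|S|\rfloor\le|S\cap\mathrm{col}^{-1}(i)|\le\lceil\beta_i|S|\rceil$. The colorful bi-partition problem asks for a set $L\subseteq V$ with $|L|=k$ and $L$ $(\bar\alpha,\bar\beta)$-colorful, minimizing $\mathrm{cost}(L)=\sum_{(y,x)\in A:\,x\in L,\,y\in V\setminus L}w(y,x)$ (total weight of arcs from $V\setminus L$ into $L$). An optimal colorful bi-partition is a partition $(L,V\setminus L)$ with $L$ feasible and of minimum cost. *)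

theory Defs
  imports Complex_Main
begin

section \<open>Weighted colored tournaments\<close>

record 'v colored_tournament =
  verts :: "'v set"
  arcs :: "('v \<times> 'v) set"
  weight :: "'v \<times> 'v \<Rightarrow> real"
  num_colors :: nat
  color :: "'v \<Rightarrow> nat"

text \<open>The values of \<open>weight\<close> outside \<open>arcs\<close> and of \<open>color\<close> outside \<open>verts\<close> are junk; nothing below
  depends on them.\<close>

definition weighted_colored_tournament :: "'v colored_tournament \<Rightarrow> bool" where
  "weighted_colored_tournament T \<longleftrightarrow>
     finite (verts T) \<and>
     arcs T = {(u, v). u \<in> verts T \<and> v \<in> verts T \<and> u \<noteq> v} \<and>
     (\<forall>a \<in> arcs T. 0 \<le> weight T a) \<and>
     1 \<le> num_colors T \<and>
     (\<forall>v \<in> verts T. color T v \<in> {1..num_colors T})"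

definition probability_constraints :: "'v colored_tournament \<Rightarrow> bool" where
  "probability_constraints T \<longleftrightarrow>
     (\<forall>i \<in> verts T. \<forall>j \<in> verts T. i \<noteq> j \<longrightarrow> weight T (i, j) + weight T (j, i) = 1)"

text \<open>There are no loops, so the constraint only makes sense for pairwise distinct vertices. (With
  the convention that loops have weight 0, the remaining instances hold automatically.)\<close>

definition triangle_constraints :: "'v colored_tournament \<Rightarrow> bool" where
  "triangle_constraints T \<longleftrightarrow>
     (\<forall>i \<in> verts T. \<forall>j \<in> verts T. \<forall>k \<in> verts T.
        i \<noteq> j \<longrightarrow> j \<noteq> k \<longrightarrow> i \<noteq> k \<longrightarrow> weight T (i, j) \<le> weight T (i, k) + weight T (k, j))"

definition colorful ::
  "'v colored_tournament \<Rightarrow> (nat \<Rightarrow> real) \<Rightarrow> (nat \<Rightarrow> real) \<Rightarrow> 'v set \<Rightarrow> bool" where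
  "colorful T \<alpha> \<beta> S \<longleftrightarrow>
     (\<forall>i \<in> {1..num_colors T}.
        \<lfloor>\<alpha> i * real (card S)\<rfloor> \<le> int (card (S \<inter> {v \<in> verts T. color T v = i})) \<and>
        int (card (S \<inter> {v \<in> verts T. color T v = i})) \<le> \<lceil>\<beta> i * real (card S)\<rceil>)"

definition cost :: "'v colored_tournament \<Rightarrow> 'v set \<Rightarrow> real" where
  "cost T L = (\<Sum>(y, x) \<in> {(y, x) \<in> arcs T. x \<in> L \<and> y \<in> verts T - L}. weight T (y, x))"

definition feasible ::
  "'v colored_tournament \<Rightarrow> int \<Rightarrow> (nat \<Rightarrow> real) \<Rightarrow> (nat \<Rightarrow> real) \<Rightarrow> 'v set \<Rightarrow> bool" where
  "feasible T k \<alpha> \<beta> L \<longleftrightarrow> L \<subseteq> verts T \<and> int (card L) = k \<and> colorful T \<alpha> \<beta> L"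

definition optimal_colorful_bipartition ::
  "'v colored_tournament \<Rightarrow> int \<Rightarrow> (nat \<Rightarrow> real) \<Rightarrow> (nat \<Rightarrow> real) \<Rightarrow> 'v set \<times> 'v set \<Rightarrow> bool" where
  "optimal_colorful_bipartition T k \<alpha> \<beta> P \<longleftrightarrow>
     snd P = verts T - fst P \<and> feasible T k \<alpha> \<beta> (fst P) \<and>
     (\<forall>L'. feasible T k \<alpha> \<beta> L' \<longrightarrow> cost T (fst P) \<le> cost T L')"


section \<open>Algorithms: programs for a real RAM\<close>

text \<open>
  A program is a finite piece of syntax over integer and real variables and over integer and real
  arrays (random access memory). Every operation has unit cost. On integers only constants,
  addition, subtraction and comparison are available (no multiplication, so the bit length is at most
  linear in the time); on reals the field operations and comparison (no rounding). The only real
  constants are the images of integers, so no information can be hidden in them.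
\<close>

type_synonym name = string

datatype iexp =
    IConst int
  | IVar name
  | IGet name iexp
  | IAdd iexp iexp
  | ISub iexp iexp

datatype rexp =
    ROfInt iexp
  | RVar name
  | RGet name iexp
  | RAdd rexp rexp
  | RSub rexp rexp
  | RMul rexp rexp
  | RDiv rexp rexp

datatype bexp =
    ILess iexp iexp
  | RLess rexp rexp
  | BNot bexp
  | BAnd bexp bexp

datatype com =
    Skip
  | IAssign name iexp
  | IPut name iexp iexp
  | RAssign name rexp
  | RPut name iexp rexp
  | Seq com com
  | Cond bexp com com
  | While bexp com

record state =
  ivars :: "name \<Rightarrow> int"
  rvars :: "name \<Rightarrow> real"
  iarrs :: "name \<Rightarrow> int \<Rightarrow> int"
  rarrs :: "name \<Rightarrow> int \<Rightarrow> real"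

primrec ival :: "iexp \<Rightarrow> state \<Rightarrow> int" where
  "ival (IConst c) s = c"
| "ival (IVar x) s = ivars s x"
| "ival (IGet a e) s = iarrs s a (ival e s)"
| "ival (IAdd e f) s = ival e s + ival f s"
| "ival (ISub e f) s = ival e s - ival f s"

text \<open>Division is total, with \<open>x / 0 = 0\<close>.\<close>

primrec rval :: "rexp \<Rightarrow> state \<Rightarrow> real" where
  "rval (ROfInt e) s = real_of_int (ival e s)"
| "rval (RVar x) s = rvars s x"
| "rval (RGet a e) s = rarrs s a (ival e s)"
| "rval (RAdd e f) s = rval e s + rval f s"
| "rval (RSub e f) s = rval e s - rval f s"
| "rval (RMul e f) s = rval e s * rval f s"
| "rval (RDiv e f) s = rval e s / rval f s"

primrec bval :: "bexp \<Rightarrow> state \<Rightarrow> bool" where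
  "bval (ILess e f) s \<longleftrightarrow> ival e s < ival f s"
| "bval (RLess e f) s \<longleftrightarrow> rval e s < rval f s"
| "bval (BNot b) s \<longleftrightarrow> \<not> bval b s"
| "bval (BAnd b c) s \<longleftrightarrow> bval b s \<and> bval c s"

text \<open>The time to evaluate an expression is its number of nodes.\<close>

primrec itime :: "iexp \<Rightarrow> nat" where
  "itime (IConst c) = 1"
| "itime (IVar x) = 1"
| "itime (IGet a e) = 1 + itime e"
| "itime (IAdd e f) = 1 + itime e + itime f"
| "itime (ISub e f) = 1 + itime e + itime f"

primrec rtime :: "rexp \<Rightarrow> nat" where
  "rtime (ROfInt e) = 1 + itime e"
| "rtime (RVar x) = 1"
| "rtime (RGet a e) = 1 + itime e"
| "rtime (RAdd e f) = 1 + rtime e + rtime f"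
| "rtime (RSub e f) = 1 + rtime e + rtime f"
| "rtime (RMul e f) = 1 + rtime e + rtime f"
| "rtime (RDiv e f) = 1 + rtime e + rtime f"

primrec btime :: "bexp \<Rightarrow> nat" where
  "btime (ILess e f) = 1 + itime e + itime f"
| "btime (RLess e f) = 1 + rtime e + rtime f"
| "btime (BNot b) = 1 + btime b"
| "btime (BAnd b c) = 1 + btime b + btime c"

definition iput :: "name \<Rightarrow> int \<Rightarrow> int \<Rightarrow> state \<Rightarrow> state" where
  "iput a i v s = s\<lparr>iarrs := (iarrs s)(a := (iarrs s a)(i := v))\<rparr>"

definition rput :: "name \<Rightarrow> int \<Rightarrow> real \<Rightarrow> state \<Rightarrow> state" where
  "rput a i v s = s\<lparr>rarrs := (rarrs s)(a := (rarrs s a)(i := v))\<rparr>"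

text \<open>\<open>exec c s t s'\<close>: started in state \<open>s\<close>, program \<open>c\<close> halts after time \<open>t\<close> in state \<open>s'\<close>.\<close>

inductive exec :: "com \<Rightarrow> state \<Rightarrow> nat \<Rightarrow> state \<Rightarrow> bool" where
  Skip: "exec Skip s 1 s"
| IAssign: "exec (IAssign x e) s (1 + itime e) (s\<lparr>ivars := (ivars s)(x := ival e s)\<rparr>)"
| IPut: "exec (IPut a e f) s (1 + itime e + itime f) (iput a (ival e s) (ival f s) s)"
| RAssign: "exec (RAssign x e) s (1 + rtime e) (s\<lparr>rvars := (rvars s)(x := rval e s)\<rparr>)"
| RPut: "exec (RPut a e f) s (1 + itime e + rtime f) (rput a (ival e s) (rval f s) s)"
| Seq: "exec c s t s' \<Longrightarrow> exec d s' t' s'' \<Longrightarrow> exec (Seq c d) s (t + t') s''"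
| CondTrue: "bval b s \<Longrightarrow> exec c s t s' \<Longrightarrow> exec (Cond b c d) s (1 + btime b + t) s'"
| CondFalse: "\<not> bval b s \<Longrightarrow> exec d s t s' \<Longrightarrow> exec (Cond b c d) s (1 + btime b + t) s'"
| WhileFalse: "\<not> bval b s \<Longrightarrow> exec (While b c) s (1 + btime b) s"
| WhileTrue: "bval b s \<Longrightarrow> exec c s t s' \<Longrightarrow> exec (While b c) s' t' s'' \<Longrightarrow>
    exec (While b c) s (1 + btime b + t + t') s''"

inductive_cases exec_SkipE: "exec Skip s t s'"
  and exec_IAssignE: "exec (IAssign x e) s t s'"
  and exec_IPutE: "exec (IPut a e f) s t s'"
  and exec_RAssignE: "exec (RAssign x e) s t s'"
  and exec_RPutE: "exec (RPut a e f) s t s'"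
  and exec_SeqE: "exec (Seq c d) s t s'"
  and exec_CondE: "exec (Cond b c d) s t s'"
  and exec_WhileE: "exec (While b c) s t s'"

theorem exec_deterministic:
  "exec c s t s' \<Longrightarrow> exec c s u s'' \<Longrightarrow> u = t \<and> s'' = s'"
proof (induction c s t s' arbitrary: u s'' rule: exec.induct)
  case Skip then show ?case by (auto elim: exec_SkipE)
next
  case IAssign then show ?case by (auto elim: exec_IAssignE)
next
  case IPut then show ?case by (auto elim: exec_IPutE)
next
  case RAssign then show ?case by (auto elim: exec_RAssignE)
next
  case RPut then show ?case by (auto elim: exec_RPutE)
next
  case (Seq c s t s' d t' s2)
  from Seq.prems obtain v r v' where "exec c s v r" "exec d r v' s''" "u = v + v'"
    by (rule exec_SeqE)
  then show ?case using Seq.IH by metis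
next
  case (CondTrue b s c t s' d)
  from CondTrue.prems CondTrue.hyps obtain v where "exec c s v s''" "u = 1 + btime b + v"
    by (auto elim: exec_CondE)
  then show ?case using CondTrue.IH by metis
next
  case (CondFalse b s d t s' c)
  from CondFalse.prems CondFalse.hyps obtain v where "exec d s v s''" "u = 1 + btime b + v"
    by (auto elim: exec_CondE)
  then show ?case using CondFalse.IH by metis
next
  case (WhileFalse b s c)
  from WhileFalse.prems WhileFalse.hyps show ?case by (auto elim: exec_WhileE)
next
  case (WhileTrue b s c t s' t' s2)
  from WhileTrue.prems WhileTrue.hyps obtain v r v' where
    "exec c s v r" "exec (While b c) r v' s''" "u = 1 + btime b + v + v'"
    by (auto elim: exec_WhileE)
  then show ?case using WhileTrue.IH by metis
qed


section \<open>Input and output\<close>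

text \<open>
  The vertices of an input tournament are \<open>0, \<dots>, n - 1\<close>. Array \<open>w\<close> is the weight matrix in row-major
  order: entry \<open>u * n + v\<close> is the weight of the arc \<open>(u, v)\<close>, with 0 on the diagonal. Memory that
  does not hold input is 0.
\<close>

definition input_state ::
  "nat colored_tournament \<Rightarrow> int \<Rightarrow> (nat \<Rightarrow> real) \<Rightarrow> (nat \<Rightarrow> real) \<Rightarrow> state" where
  "input_state T k \<alpha> \<beta> =
     (let n = card (verts T); g = num_colors T in
      \<lparr> ivars = (\<lambda>_. 0)(''n'' := int n, ''g'' := int g, ''k'' := k),
        rvars = (\<lambda>_. 0),
        iarrs = (\<lambda>_ _. 0)
          (''col'' := \<lambda>i. if 0 \<le> i \<and> i < int n then int (color T (nat i)) else 0),
        rarrs = (\<lambda>_ _. 0)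
          (''w'' := \<lambda>i. if 0 \<le> i \<and> (nat i div n, nat i mod n) \<in> arcs T
                       then weight T (nat i div n, nat i mod n) else 0,
           ''alpha'' := \<lambda>i. if 1 \<le> i \<and> i \<le> int g then \<alpha> (nat i) else 0,
           ''beta'' := \<lambda>i. if 1 \<le> i \<and> i \<le> int g then \<beta> (nat i) else 0) \<rparr>)"

text \<open>The computed bi-partition is read off array \<open>L\<close>, the characteristic vector of its left part.\<close>

definition output_bipartition :: "nat colored_tournament \<Rightarrow> state \<Rightarrow> nat set \<times> nat set" where
  "output_bipartition T s =
     ({v \<in> verts T. iarrs s ''L'' (int v) \<noteq> 0}, {v \<in> verts T. iarrs s ''L'' (int v) = 0})"

end

theory Submission
  imports Defs
begin

text \<open>
  Under the probability constraints the arcs inside \<open>L\<close> have total weight \<open>|L| (|L| - 1) / 2\<close>, so on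
  sets of size \<open>k\<close> the cost is, up to a constant, the sum of the weighted in-degrees of the members of
  \<open>L\<close>. A greedy algorithm minimises this linear objective: first take vertices of least in-degree among
  those whose color is still below its lower quota, then vertices of least in-degree among those whose
  color is below its upper quota, until \<open>k\<close> vertices are chosen. An exchange argument keeps the chosen
  set inside some optimal solution. Each of the at most \<open>2 |V|\<close> choices is made by a linear scan, which
  fits the bound because \<open>|A| = |V| (|V| - 1)\<close>. The number of colors is not bounded in terms of \<open>|V|\<close>,
  so the program only looks at the quotas of colors that occur; the remaining constraints do not
  depend on the chosen set of size \<open>k\<close>.
\<close>

section \<open>Timed execution\<close>

text \<open>Total correctness with an upper bound on the time. A bound, rather than the exact time,
  lets branches of different length share one estimate.\<close>

definition runs :: "com \<Rightarrow> state \<Rightarrow> nat \<Rightarrow> (state \<Rightarrow> bool) \<Rightarrow> bool" where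
  "runs c s t Q \<longleftrightarrow> (\<exists>t' s'. exec c s t' s' \<and> t' \<le> t \<and> Q s')"

lemma runs_mono:
  "runs c s t Q \<Longrightarrow> t \<le> u \<Longrightarrow> (\<And>s'. Q s' \<Longrightarrow> R s') \<Longrightarrow> runs c s u R"
  unfolding runs_def by (meson order_trans)

lemma runs_Seq:
  assumes "runs c s t Q" and "\<And>s'. Q s' \<Longrightarrow> runs d s' u R"
  shows "runs (Seq c d) s (t + u) R"
  using assms unfolding runs_def by (meson add_mono exec.Seq)

section \<open>Loop-free programs\<close>

primrec loop_free :: "com \<Rightarrow> bool" where
  "loop_free Skip \<longleftrightarrow> True"
| "loop_free (IAssign x e) \<longleftrightarrow> True"
| "loop_free (IPut a e f) \<longleftrightarrow> True"
| "loop_free (RAssign x e) \<longleftrightarrow> True"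
| "loop_free (RPut a e f) \<longleftrightarrow> True"
| "loop_free (Seq c d) \<longleftrightarrow> loop_free c \<and> loop_free d"
| "loop_free (Cond b c d) \<longleftrightarrow> loop_free c \<and> loop_free d"
| "loop_free (While b c) \<longleftrightarrow> False"

text \<open>The value at \<open>While\<close> is junk; \<open>effect\<close> and \<open>max_time\<close> are meant for loop-free programs.\<close>

primrec effect :: "com \<Rightarrow> state \<Rightarrow> state" where
  "effect Skip s = s"
| "effect (IAssign x e) s = s\<lparr>ivars := (ivars s)(x := ival e s)\<rparr>"
| "effect (IPut a e f) s = iput a (ival e s) (ival f s) s"
| "effect (RAssign x e) s = s\<lparr>rvars := (rvars s)(x := rval e s)\<rparr>"
| "effect (RPut a e f) s = rput a (ival e s) (rval f s) s"
| "effect (Seq c d) s = effect d (effect c s)"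
| "effect (Cond b c d) s = (if bval b s then effect c s else effect d s)"
| "effect (While b c) s = s"

primrec max_time :: "com \<Rightarrow> nat" where
  "max_time Skip = 1"
| "max_time (IAssign x e) = 1 + itime e"
| "max_time (IPut a e f) = 1 + itime e + itime f"
| "max_time (RAssign x e) = 1 + rtime e"
| "max_time (RPut a e f) = 1 + itime e + rtime f"
| "max_time (Seq c d) = max_time c + max_time d"
| "max_time (Cond b c d) = 1 + btime b + max (max_time c) (max_time d)"
| "max_time (While b c) = 0"

lemma exec_loop_free:
  "loop_free c \<Longrightarrow> \<exists>t \<le> max_time c. exec c s t (effect c s)"
proof (induction c arbitrary: s)
  case (Seq c d)
  then obtain t u where "t \<le> max_time c" "exec c s t (effect c s)"
    "u \<le> max_time d" "exec d (effect c s) u (effect d (effect c s))"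
    by (meson loop_free.simps(6))
  then show ?case by (auto intro!: exI[of _ "t + u"] exec.Seq)
next
  case (Cond b c d)
  show ?case
  proof (cases "bval b s")
    case True
    with Cond obtain t where "t \<le> max_time c" "exec c s t (effect c s)" by auto
    with True show ?thesis by (intro exI[of _ "1 + btime b + t"]) (auto intro!: exec.CondTrue[simplified])
  next
    case False
    with Cond obtain t where "t \<le> max_time d" "exec d s t (effect d s)" by auto
    with False show ?thesis by (intro exI[of _ "1 + btime b + t"]) (auto intro!: exec.CondFalse[simplified])
  qed
next
  case Skip
  show ?case using exec.Skip by auto
next
  case (IAssign x e)
  show ?case using exec.IAssign[of x e s] by auto
next
  case (IPut a e f)
  show ?case using exec.IPut[of a e f s] by auto
next
  case (RAssign x e)
  show ?case using exec.RAssign[of x e s] by auto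
next
  case (RPut a e f)
  show ?case using exec.RPut[of a e f s] by auto
qed simp

lemma runs_loop_free: "loop_free c \<Longrightarrow> Q (effect c s) \<Longrightarrow> runs c s (max_time c) Q"
  unfolding runs_def using exec_loop_free by blast

definition For :: "name \<Rightarrow> com \<Rightarrow> com" where
  "For x c = Seq (IAssign x (IConst 0))
     (While (ILess (IVar x) (IVar ''n'')) (Seq c (IAssign x (IAdd (IVar x) (IConst 1)))))"

abbreviation set_ivar :: "name \<Rightarrow> int \<Rightarrow> state \<Rightarrow> state" where
  "set_ivar x a s \<equiv> s\<lparr>ivars := (ivars s)(x := a)\<rparr>"

text \<open>A test costs 4 and an increment costs 4, hence 8 per round besides the body; the initial
  assignment costs 2 and the failing last test 4, hence the 6. The invariant is demanded after the
  increment, which is the \<open>set_ivar\<close> in \<open>step\<close>.\<close>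

lemma runs_For:
  assumes n: "ivars s ''n'' = int N" and x: "x \<noteq> ''n''"
    and init: "I 0 (set_ivar x 0 s)"
    and step: "\<And>i s. i < N \<Longrightarrow> ivars s ''n'' = int N \<Longrightarrow> ivars s x = int i \<Longrightarrow> I i s \<Longrightarrow>
      runs c s t (\<lambda>s'. ivars s' ''n'' = int N \<and> ivars s' x = int i \<and>
        I (Suc i) (set_ivar x (1 + int i) s'))"
  shows "runs (For x c) s (6 + N * (8 + t)) (I N)"
proof -
  let ?B = "ILess (IVar x) (IVar ''n'')"
  let ?W = "While ?B (Seq c (IAssign x (IAdd (IVar x) (IConst 1))))"
  have loop: "runs ?W s ((N - i) * (8 + t) + 4) (I N)"
    if "i \<le> N" "ivars s ''n'' = int N" "ivars s x = int i" "I i s" for i s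
    using that
  proof (induction "N - i" arbitrary: i s)
    case 0
    then have "exec ?W s (1 + btime ?B) s" by (intro exec.WhileFalse) simp
    with 0 show ?case unfolding runs_def by force
  next
    case (Suc m)
    then have "i < N" by simp
    obtain t1 s1 where s1: "exec c s t1 s1" "t1 \<le> t" "ivars s1 ''n'' = int N" "ivars s1 x = int i"
      "I (Suc i) (set_ivar x (1 + int i) s1)"
      using step[OF \<open>i < N\<close>] Suc.prems unfolding runs_def by blast
    let ?s2 = "set_ivar x (1 + int i) s1"
    have "exec (IAssign x (IAdd (IVar x) (IConst 1))) s1 4 ?s2"
      using exec.IAssign[of x "IAdd (IVar x) (IConst 1)" s1] s1(4) by (simp add: add.commute eval_nat_numeral)
    then have body: "exec (Seq c (IAssign x (IAdd (IVar x) (IConst 1)))) s (t1 + 4) ?s2"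
      by (rule exec.Seq[OF s1(1)])
    have "runs ?W ?s2 ((N - Suc i) * (8 + t) + 4) (I N)"
      using Suc.hyps(1)[of "Suc i" ?s2] Suc.hyps(2) \<open>i < N\<close> s1 x by simp
    then obtain t2 s3 where s3: "exec ?W ?s2 t2 s3" "t2 \<le> (N - Suc i) * (8 + t) + 4" "I N s3"
      unfolding runs_def by blast
    have "exec ?W s (1 + btime ?B + (t1 + 4) + t2) s3"
      using Suc.prems \<open>i < N\<close> by (intro exec.WhileTrue[OF _ body s3(1)]) simp
    moreover have "(N - i) * (8 + t) = (N - Suc i) * (8 + t) + (8 + t)"
      using \<open>i < N\<close> by (metis Suc_diff_Suc add.commute mult_Suc)
    ultimately show ?case
      unfolding runs_def using s3 s1(2) by (intro exI[of _ "1 + btime ?B + (t1 + 4) + t2"]) auto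
  qed
  have "runs (IAssign x (IConst 0)) s (max_time (IAssign x (IConst 0)))
      (\<lambda>s'. ivars s' ''n'' = int N \<and> ivars s' x = 0 \<and> I 0 s')"
    by (rule runs_loop_free) (use n x init in auto)
  then have "runs (For x c) s (max_time (IAssign x (IConst 0)) + (N * (8 + t) + 4)) (I N)"
    unfolding For_def by (rule runs_Seq) (use loop[of 0] in auto)
  then show ?thesis by (rule runs_mono) auto
qed


section \<open>The program\<close>

text \<open>The index \<open>u * n + v\<close> would need an integer product, which the machine
  lacks; instead the pointer \<open>p\<close> walks once through the row-major matrix.\<close>

definition add_entry :: com where
  "add_entry = Seq
     (RPut ''deg'' (IVar ''v'') (RAdd (RGet ''deg'' (IVar ''v'')) (RGet ''w'' (IVar ''p''))))
     (IAssign ''p'' (IAdd (IVar ''p'') (IConst 1)))"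

definition in_degrees :: com where
  "in_degrees = For ''u'' (For ''v'' add_entry)"

text \<open>With only \<open>BNot\<close> and \<open>BAnd\<close> at hand, the negated conjunction
  says: nothing found yet, or \<open>v\<close> has strictly smaller in-degree. Reading
  \<open>deg\<close> at -1 is harmless because arrays are total.\<close>

definition compare_best :: "bexp \<Rightarrow> com" where
  "compare_best b =
     Cond (BAnd b (BNot (BAnd (BNot (ILess (IVar ''best'') (IConst 0)))
              (BNot (RLess (RGet ''deg'' (IVar ''v'')) (RGet ''deg'' (IVar ''best'')))))))
       (IAssign ''best'' (IVar ''v'')) Skip"

definition find_best :: "bexp \<Rightarrow> com" where
  "find_best b = Seq (IAssign ''best'' (IConst (-1))) (For ''v'' (compare_best b))"

definition choose_best :: com where
  "choose_best = Cond (ILess (IVar ''best'') (IConst 0)) Skip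
     (Seq (IPut ''L'' (IVar ''best'') (IConst 1))
     (Seq (IPut ''cnt'' (IGet ''col'' (IVar ''best''))
             (IAdd (IGet ''cnt'' (IGet ''col'' (IVar ''best''))) (IConst 1)))
        (IAssign ''total'' (IAdd (IVar ''total'') (IConst 1)))))"

text \<open>As many rounds as vertices suffice: a round adds a vertex or finds no candidate, and
  from then on the set stays as it is.\<close>

definition greedy :: "bexp \<Rightarrow> com" where
  "greedy b = For ''r'' (Seq (find_best b) choose_best)"

text \<open>For integers \<open>m\<close> we have \<open>m < \<lfloor>x\<rfloor>\<close> iff \<open>\<not> x < m + 1\<close>, and \<open>m < \<lceil>x\<rceil>\<close> iff \<open>m < x\<close>: the quotas
  can be compared without a rounding operation.\<close>

definition below_lower :: bexp where
  "below_lower = BAnd (ILess (IGet ''L'' (IVar ''v'')) (IConst 1))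
     (BNot (RLess (RMul (RGet ''alpha'' (IGet ''col'' (IVar ''v''))) (ROfInt (IVar ''k'')))
       (ROfInt (IAdd (IGet ''cnt'' (IGet ''col'' (IVar ''v''))) (IConst 1)))))"

definition below_upper :: bexp where
  "below_upper = BAnd (ILess (IGet ''L'' (IVar ''v'')) (IConst 1))
     (BAnd (ILess (IVar ''total'') (IVar ''k''))
       (RLess (ROfInt (IGet ''cnt'' (IGet ''col'' (IVar ''v''))))
         (RMul (RGet ''beta'' (IGet ''col'' (IVar ''v''))) (ROfInt (IVar ''k'')))))"

definition bipartition_program :: com where
  "bipartition_program = Seq in_degrees (Seq (greedy below_lower) (greedy below_upper))"


section \<open>The cost is linear in the chosen set\<close>

definition in_degree :: "'v colored_tournament \<Rightarrow> 'v \<Rightarrow> real" where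
  "in_degree T v = (\<Sum>u \<in> verts T - {v}. weight T (u, v))"

text \<open>An arc into a member of \<open>L\<close> starts outside \<open>L\<close> and counts in
  the cost, or starts inside. Each unordered pair inside \<open>L\<close> carries weight 1, so the
  inner part depends on \<open>card L\<close> only.\<close>

lemma cost_eq_sum_in_degree:
  assumes T: "weighted_colored_tournament T" "probability_constraints T" and L: "L \<subseteq> verts T"
  shows "cost T L = (\<Sum>x\<in>L. in_degree T x) - real (card L) * (real (card L) - 1) / 2"
proof -
  let ?w = "weight T" and ?V = "verts T"
  have fin: "finite ?V" "finite L"
    using T L finite_subset unfolding weighted_colored_tournament_def by auto
  have arcs: "arcs T = {(u, v). u \<in> ?V \<and> v \<in> ?V \<and> u \<noteq> v}"
    using T(1) unfolding weighted_colored_tournament_def by simp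
  have "cost T L = (\<Sum>(y, x) \<in> (?V - L) \<times> L. ?w (y, x))"
    unfolding cost_def using L by (intro sum.cong) (auto simp: arcs)
  also have "\<dots> = (\<Sum>x\<in>L. \<Sum>y\<in>?V - L. ?w (y, x))"
    by (subst sum.cartesian_product[symmetric], rule sum.swap)
  also have "\<dots> = (\<Sum>x\<in>L. in_degree T x - (\<Sum>y\<in>L - {x}. ?w (y, x)))"
  proof (rule sum.cong[OF refl])
    fix x assume "x \<in> L"
    then have "?V - {x} = (?V - L) \<union> (L - {x})" using L by auto
    then have "in_degree T x = (\<Sum>y\<in>?V - L. ?w (y, x)) + (\<Sum>y\<in>L - {x}. ?w (y, x))"
      unfolding in_degree_def using fin by (auto intro: sum.union_disjoint)
    then show "(\<Sum>y\<in>?V - L. ?w (y, x)) = in_degree T x - (\<Sum>y\<in>L - {x}. ?w (y, x))" by simp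
  qed
  also have "\<dots> = (\<Sum>x\<in>L. in_degree T x) - (\<Sum>x\<in>L. \<Sum>y\<in>L - {x}. ?w (y, x))"
    by (rule sum_subtractf)
  also have "(\<Sum>x\<in>L. \<Sum>y\<in>L - {x}. ?w (y, x)) = real (card L) * (real (card L) - 1) / 2"
  proof -
    let ?s = "\<Sum>x\<in>L. \<Sum>y\<in>L - {x}. ?w (y, x)"
    \<comment> \<open>The diagonal is moved into the summand, so that both sums run over all of
      \<open>L\<close> and can be swapped. The inner weight thus equals its transpose, and doubling
      it pairs each arc with its reverse.\<close>
    have cond: "(\<Sum>y\<in>L - {x}. f y) = (\<Sum>y\<in>L. if x = y then 0 else f y)" for x and f :: "'a \<Rightarrow> real"
      using fin(2) by (intro sum.mono_neutral_cong_left) auto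
    have "?s = (\<Sum>x\<in>L. \<Sum>y\<in>L - {x}. ?w (x, y))"
      unfolding cond by (subst sum.swap) (auto intro!: sum.cong)
    then have "2 * ?s = (\<Sum>x\<in>L. \<Sum>y\<in>L - {x}. ?w (y, x) + ?w (x, y))"
      by (simp add: sum.distrib)
    also have "\<dots> = (\<Sum>x\<in>L. \<Sum>y\<in>L - {x}. 1)"
      using T(2) L unfolding probability_constraints_def by (intro sum.cong) auto
    also have "\<dots> = (\<Sum>x\<in>L. real (card L) - 1)"
    proof (rule sum.cong[OF refl])
      fix x assume "x \<in> L"
      \<comment> \<open>Positivity lets the truncated difference \<open>card L - 1\<close> pass to
        the reals.\<close>
      then have "0 < card L" using fin card_gt_0_iff by blast
      with \<open>x \<in> L\<close> show "(\<Sum>y\<in>L - {x}. 1) = real (card L) - 1"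
        by (simp add: of_nat_diff Suc_le_eq)
    qed
    finally show ?thesis by simp
  qed
  finally show ?thesis .
qed


section \<open>The exchange argument\<close>

definition color_count :: "'v colored_tournament \<Rightarrow> 'v set \<Rightarrow> nat \<Rightarrow> nat" where
  "color_count T S c = card (S \<inter> {v \<in> verts T. color T v = c})"

locale bipartition_instance =
  fixes T :: "nat colored_tournament" and k :: int and \<alpha> \<beta> :: "nat \<Rightarrow> real"
  assumes tournament: "weighted_colored_tournament T"
    and verts_lessThan: "verts T = {..<card (verts T)}"
    and probability: "probability_constraints T"
begin

abbreviation "n \<equiv> card (verts T)"

lemma verts_iff: "v \<in> verts T \<longleftrightarrow> v < n"
  using verts_lessThan by (metis lessThan_iff)

lemma finite_verts: "finite (verts T)"
  using tournament unfolding weighted_colored_tournament_def by simp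

lemma color_range: "v \<in> verts T \<Longrightarrow> color T v \<in> {1..num_colors T}"
  using tournament unfolding weighted_colored_tournament_def by simp

lemma color_count_insert:
  assumes "v \<in> verts T" "v \<notin> S"
  shows "color_count T (insert v S) c = color_count T S c + of_bool (color T v = c)"
proof (cases "color T v = c")
  case True
  then have "insert v S \<inter> {v \<in> verts T. color T v = c} = insert v (S \<inter> {v \<in> verts T. color T v = c})"
    using assms by auto
  with True assms finite_verts show ?thesis unfolding color_count_def by simp
next
  case False
  then have "insert v S \<inter> {v \<in> verts T. color T v = c} = S \<inter> {v \<in> verts T. color T v = c}" by auto
  with False show ?thesis unfolding color_count_def by simp
qed

lemma color_count_mono: "S \<subseteq> L \<Longrightarrow> color_count T S c \<le> color_count T L c"
  unfolding color_count_def using finite_verts by (intro card_mono) auto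

text \<open>The source of exchange partners of a prescribed color: if all such members of
  \<open>L\<close> were in \<open>S\<close>, then \<open>S\<close> would count at least as
  many.\<close>

lemma color_count_less_obtain:
  assumes "L \<subseteq> verts T" "color_count T S c < color_count T L c"
  obtains u where "u \<in> L" "u \<notin> S" "color T u = c"
proof -
  have "\<not> L \<inter> {v \<in> verts T. color T v = c} \<subseteq> S \<inter> {v \<in> verts T. color T v = c}"
  proof
    assume "L \<inter> {v \<in> verts T. color T v = c} \<subseteq> S \<inter> {v \<in> verts T. color T v = c}"
    then have "color_count T L c \<le> color_count T S c"
      unfolding color_count_def using finite_verts by (intro card_mono) auto
    with assms(2) show False by simp
  qed
  then show thesis using that by auto
qed

lemma color_count_less:
  assumes "u \<in> L" "u \<notin> S" "S \<subseteq> L" "L \<subseteq> verts T"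
  shows "color_count T S (color T u) < color_count T L (color T u)"
proof -
  have "color_count T (insert u S) (color T u) = color_count T S (color T u) + 1"
    using color_count_insert assms by auto
  then show ?thesis using color_count_mono[of "insert u S" L "color T u"] assms by auto
qed

text \<open>Once the size is fixed to \<open>k\<close>, the quotas become numbers that depend on the
  color alone.\<close>

lemma feasible_iff:
  "feasible T k \<alpha> \<beta> L \<longleftrightarrow> L \<subseteq> verts T \<and> int (card L) = k \<and>
     (\<forall>c \<in> {1..num_colors T}. \<lfloor>\<alpha> c * of_int k\<rfloor> \<le> int (color_count T L c) \<and>
        int (color_count T L c) \<le> \<lceil>\<beta> c * of_int k\<rceil>)"
  unfolding feasible_def colorful_def color_count_def by auto

definition optimal :: "nat set \<Rightarrow> bool" where
  "optimal L \<longleftrightarrow> feasible T k \<alpha> \<beta> L \<and> (\<forall>L'. feasible T k \<alpha> \<beta> L' \<longrightarrow> cost T L \<le> cost T L')"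

lemma optimal_exists:
  assumes "feasible T k \<alpha> \<beta> L" shows "\<exists>L. optimal L"
proof -
  let ?F = "{L. feasible T k \<alpha> \<beta> L}"
  have "finite ?F"
    by (rule finite_subset[of _ "Pow (verts T)"]) (auto simp: feasible_iff finite_verts)
  moreover have "?F \<noteq> {}" using assms by blast
  ultimately have "arg_min_on (cost T) ?F \<in> ?F"
    "\<And>L'. L' \<in> ?F \<Longrightarrow> cost T (arg_min_on (cost T) ?F) \<le> cost T L'"
    by (rule arg_min_if_finite(1), rule arg_min_least)
  then show ?thesis unfolding optimal_def by blast
qed

text \<open>With equal colors no count changes. Otherwise the color of \<open>u\<close> loses one
  and that of \<open>v\<close> gains one, and \<open>lower\<close> and \<open>upper\<close> are
  exactly the slack this takes. The size is kept, so the linear form of the cost shows that it does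
  not grow.\<close>

lemma optimal_swap:
  assumes L: "optimal L" and u: "u \<in> L" and v: "v \<in> verts T" "v \<notin> L"
    and deg: "in_degree T v \<le> in_degree T u"
    and lower: "color T u \<noteq> color T v \<Longrightarrow>
      \<lfloor>\<alpha> (color T u) * of_int k\<rfloor> < int (color_count T L (color T u))"
    and upper: "color T u \<noteq> color T v \<Longrightarrow>
      int (color_count T L (color T v)) < \<lceil>\<beta> (color T v) * of_int k\<rceil>"
  shows "optimal (insert v (L - {u}))"
proof -
  let ?M = "L - {u}"
  have feas: "feasible T k \<alpha> \<beta> L" using L unfolding optimal_def by simp
  have LV: "L \<subseteq> verts T" using feas unfolding feasible_iff by simp
  have fin: "finite L" using LV finite_verts finite_subset by blast
  have L_eq: "L = insert u ?M" using u by auto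
  have cL: "color_count T L c = color_count T ?M c + of_bool (color T u = c)" for c
    using color_count_insert[of u ?M c] L_eq u LV by auto
  have cN: "color_count T (insert v ?M) c = color_count T ?M c + of_bool (color T v = c)" for c
    using color_count_insert[of v ?M c] v by auto
  have card: "card (insert v ?M) = card L"
    using card_Suc_Diff1[OF fin u] fin v(2) by simp
  have bounds: "\<lfloor>\<alpha> c * of_int k\<rfloor> \<le> int (color_count T (insert v ?M) c) \<and>
      int (color_count T (insert v ?M) c) \<le> \<lceil>\<beta> c * of_int k\<rceil>" if "c \<in> {1..num_colors T}" for c
  proof -
    have "\<lfloor>\<alpha> c * of_int k\<rfloor> \<le> int (color_count T L c)" "int (color_count T L c) \<le> \<lceil>\<beta> c * of_int k\<rceil>"
      using feas that unfolding feasible_iff by auto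
    then show ?thesis
      using lower upper cL[of c] cN[of c]
      by (cases "color T u = c"; cases "color T v = c") auto
  qed
  have feas': "feasible T k \<alpha> \<beta> (insert v ?M)"
    unfolding feasible_iff using LV v card bounds feas[unfolded feasible_iff] by auto
  have "(\<Sum>x\<in>insert v ?M. in_degree T x) \<le> (\<Sum>x\<in>L. in_degree T x)"
    using deg fin u v by (simp add: sum.remove[OF fin u])
  moreover have "insert v ?M \<subseteq> verts T" using LV v by auto
  ultimately have "cost T (insert v ?M) \<le> cost T L"
    using cost_eq_sum_in_degree[OF tournament probability, of L]
      cost_eq_sum_in_degree[OF tournament probability, of "insert v ?M"] LV card by simp
  with feas' L show ?thesis unfolding optimal_def by fastforce
qed

section \<open>Partial solutions and the two greedy phases\<close>

definition extendable :: "nat set \<Rightarrow> bool" where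
  "extendable S \<longleftrightarrow> (\<exists>L. optimal L \<and> S \<subseteq> L)"

definition lower_candidates :: "nat set \<Rightarrow> nat set" where
  "lower_candidates S = {v \<in> verts T - S.
     int (color_count T S (color T v)) < \<lfloor>\<alpha> (color T v) * of_int k\<rfloor>}"

definition upper_candidates :: "nat set \<Rightarrow> nat set" where
  "upper_candidates S = {v \<in> verts T - S. int (card S) < k \<and>
     int (color_count T S (color T v)) < \<lceil>\<beta> (color T v) * of_int k\<rceil>}"

definition lower_filled :: "nat set \<Rightarrow> bool" where
  "lower_filled S \<longleftrightarrow> (\<forall>c \<in> {1..num_colors T}. \<lfloor>\<alpha> c * of_int k\<rfloor> \<le> int (color_count T S c))"

lemma optimalD:
  assumes "optimal L"
  shows "L \<subseteq> verts T" "int (card L) = k"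
    "c \<in> {1..num_colors T} \<Longrightarrow> \<lfloor>\<alpha> c * of_int k\<rfloor> \<le> int (color_count T L c)"
    "c \<in> {1..num_colors T} \<Longrightarrow> int (color_count T L c) \<le> \<lceil>\<beta> c * of_int k\<rceil>"
  using assms unfolding optimal_def feasible_iff by auto

text \<open>If the optimal \<open>L\<close> misses \<open>v\<close>, it still meets the lower quota
  that \<open>S\<close> fails, so it has a further vertex \<open>u\<close> of the same color outside
  \<open>S\<close>. This \<open>u\<close> was a candidate too, and swapping it for \<open>v\<close>
  leaves every color count unchanged.\<close>

lemma extendable_lower_step:
  assumes "extendable S" and v: "v \<in> lower_candidates S"
    and min: "\<And>u. u \<in> lower_candidates S \<Longrightarrow> in_degree T v \<le> in_degree T u"
  shows "extendable (insert v S)"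
proof -
  obtain L where L: "optimal L" "S \<subseteq> L" using assms(1) unfolding extendable_def by blast
  have vV: "v \<in> verts T" "v \<notin> S"
    and v_low: "int (color_count T S (color T v)) < \<lfloor>\<alpha> (color T v) * of_int k\<rfloor>"
    using v unfolding lower_candidates_def by auto
  show ?thesis
  proof (cases "v \<in> L")
    case True
    with L show ?thesis unfolding extendable_def by auto
  next
    case False
    have "color_count T S (color T v) < color_count T L (color T v)"
      using v_low optimalD(3)[OF L(1) color_range[OF vV(1)]] by simp
    then obtain u where u: "u \<in> L" "u \<notin> S" "color T u = color T v"
      using color_count_less_obtain optimalD(1)[OF L(1)] by metis
    then have "u \<in> lower_candidates S"
      using v_low optimalD(1)[OF L(1)] unfolding lower_candidates_def by auto
    then have "optimal (insert v (L - {u}))"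
      using optimal_swap[OF L(1) u(1) vV(1) False] min u(3) by simp
    then show ?thesis unfolding extendable_def using L(2) u(2) by blast
  qed
qed

text \<open>The claim covers all colors, even those of no vertex: an optimal \<open>L\<close> meets
  every lower quota, so a deficit of \<open>S\<close> always exposes a vertex of that color, which
  is a candidate.\<close>

lemma lower_filled_if_no_candidates:
  assumes "extendable S" and none: "lower_candidates S = {}"
  shows "lower_filled S"
  unfolding lower_filled_def
proof (rule ballI, rule ccontr)
  fix c assume c: "c \<in> {1..num_colors T}" "\<not> \<lfloor>\<alpha> c * of_int k\<rfloor> \<le> int (color_count T S c)"
  obtain L where L: "optimal L" "S \<subseteq> L" using assms(1) unfolding extendable_def by blast
  have "color_count T S c < color_count T L c"
    using c optimalD(3)[OF L(1) c(1)] by simp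
  then obtain u where u: "u \<in> L" "u \<notin> S" "color T u = c"
    using color_count_less_obtain optimalD(1)[OF L(1)] by metis
  then have "u \<in> lower_candidates S"
    using c optimalD(1)[OF L(1)] unfolding lower_candidates_def by auto
  with none show False by simp
qed

text \<open>Along \<open>L\<close> no limit can block: \<open>S\<close> is smaller than
  \<open>L\<close> and has fewer vertices of the color of \<open>u\<close>, while \<open>L\<close>
  respects the upper quota.\<close>

lemma upper_candidates_if_extends:
  assumes L: "optimal L" "S \<subseteq> L" and u: "u \<in> L" "u \<notin> S"
  shows "u \<in> upper_candidates S"
proof -
  have "S \<subset> L" using L u by auto
  then have "card S < card L"
    using optimalD(1)[OF L(1)] finite_verts finite_subset psubset_card_mono by metis
  moreover have "u \<in> verts T" using optimalD(1)[OF L(1)] u by auto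
  ultimately show ?thesis
    using color_count_less[OF u L(2) optimalD(1)[OF L(1)]] optimalD(2)[OF L(1)] u
      optimalD(4)[OF L(1) color_range[of u]]
    unfolding upper_candidates_def by simp
qed

lemma extendable_upper_step:
  assumes "extendable S" and filled: "lower_filled S" and v: "v \<in> upper_candidates S"
    and min: "\<And>u. u \<in> upper_candidates S \<Longrightarrow> in_degree T v \<le> in_degree T u"
  shows "extendable (insert v S)"
proof -
  obtain L where L: "optimal L" "S \<subseteq> L" using assms(1) unfolding extendable_def by blast
  note LV = optimalD(1)[OF L(1)]
  have vV: "v \<in> verts T" "v \<notin> S" and card_S: "int (card S) < k"
    and v_up: "int (color_count T S (color T v)) < \<lceil>\<beta> (color T v) * of_int k\<rceil>"
    using v unfolding upper_candidates_def by auto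
  show ?thesis
  proof (cases "v \<in> L")
    case True
    with L show ?thesis unfolding extendable_def by auto
  next
    case False
    \<comment> \<open>The partner \<open>u\<close> is taken of the color of \<open>v\<close> if
      \<open>L\<close> has more of that color than \<open>S\<close>. If not, any \<open>u\<close>
      will do: the count in \<open>L\<close> is then as small as in \<open>S\<close>, so the color
      of \<open>v\<close> has room in \<open>L\<close>.\<close>
    have "\<exists>u \<in> L - S. color T u \<noteq> color T v \<longrightarrow> color_count T L (color T v) \<le> color_count T S (color T v)"
    proof (cases "color_count T S (color T v) < color_count T L (color T v)")
      case True
      then show ?thesis using color_count_less_obtain[OF LV] by (metis DiffI)
    next
      case False
      have "L \<noteq> S" using card_S optimalD(2)[OF L(1)] by auto
      with L(2) False show ?thesis by auto
    qed
    then obtain u where u: "u \<in> L" "u \<notin> S"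
      and same: "color T u \<noteq> color T v \<Longrightarrow> color_count T L (color T v) \<le> color_count T S (color T v)"
      by auto
    \<comment> \<open>\<open>S\<close> alone already meets the lower quota for the color of
      \<open>u\<close>, so \<open>L\<close>, which holds \<open>u\<close> in addition, can spare
      it.\<close>
    have "\<lfloor>\<alpha> (color T u) * of_int k\<rfloor> \<le> int (color_count T S (color T u))"
      using filled color_range[of u] u LV unfolding lower_filled_def by auto
    then have "\<lfloor>\<alpha> (color T u) * of_int k\<rfloor> < int (color_count T L (color T u))"
      using color_count_less[OF u L(2) LV] by simp
    then have "optimal (insert v (L - {u}))"
      using same v_up min[OF upper_candidates_if_extends[OF L u]]
      by (intro optimal_swap[OF L(1) u(1) vV(1) False]) auto
    then show ?thesis unfolding extendable_def using L(2) u(2) by blast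
  qed
qed

lemma optimal_if_no_candidates:
  assumes "extendable S" and "upper_candidates S = {}"
  shows "optimal S"
  using assms upper_candidates_if_extends unfolding extendable_def
  by (metis empty_iff subset_antisym subsetI)


section \<open>Correctness and running time\<close>

text \<open>The quota arrays are described only at colors that occur. Loop counters,
  \<open>best\<close> and \<open>p\<close> are left free, so that they may change while the
  represented set stays.\<close>

definition represents :: "nat set \<Rightarrow> state \<Rightarrow> bool" where
  "represents S s \<longleftrightarrow> S \<subseteq> verts T \<and> ivars s ''n'' = int n \<and> ivars s ''k'' = k \<and>
     ivars s ''total'' = int (card S) \<and>
     (\<forall>v<n. iarrs s ''col'' (int v) = int (color T v) \<and>
        rarrs s ''alpha'' (int (color T v)) = \<alpha> (color T v) \<and>
        rarrs s ''beta'' (int (color T v)) = \<beta> (color T v) \<and>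
        rarrs s ''deg'' (int v) = in_degree T v \<and>
        iarrs s ''L'' (int v) = of_bool (v \<in> S)) \<and>
     (\<forall>c. iarrs s ''cnt'' (int c) = int (color_count T S c))"

lemma represents_set_ivar:
  "x \<noteq> ''n'' \<Longrightarrow> x \<noteq> ''k'' \<Longrightarrow> x \<noteq> ''total'' \<Longrightarrow> represents S (set_ivar x a s) \<longleftrightarrow> represents S s"
  unfolding represents_def by simp

lemma below_lower_iff:
  assumes "represents S s" "v < n" "ivars s ''v'' = int v"
  shows "bval below_lower s \<longleftrightarrow> v \<in> lower_candidates S"
  using assms verts_iff[of v]
  unfolding below_lower_def lower_candidates_def represents_def
  by (auto simp: less_floor_iff not_less add.commute)

lemma below_upper_iff:
  assumes "represents S s" "v < n" "ivars s ''v'' = int v"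
  shows "bval below_upper s \<longleftrightarrow> v \<in> upper_candidates S"
  using assms verts_iff[of v]
  unfolding below_upper_def upper_candidates_def represents_def
  by (auto simp: less_ceiling_iff)

section \<open>Selection of a best candidate\<close>

definition best_among :: "nat set \<Rightarrow> int \<Rightarrow> bool" where
  "best_among E b \<longleftrightarrow> E = {} \<and> b = -1 \<or>
     (\<exists>v. b = int v \<and> v \<in> E \<and> (\<forall>u\<in>E. in_degree T v \<le> in_degree T u))"

lemma runs_find_best:
  assumes guard: "\<And>s v. represents S s \<Longrightarrow> v < n \<Longrightarrow> ivars s ''v'' = int v \<Longrightarrow> bval b s \<longleftrightarrow> v \<in> E"
    and E: "E \<subseteq> verts T" and s: "represents S s" and r: "ivars s ''r'' = r"
  shows "runs (find_best b) s (8 + n * (8 + max_time (compare_best b)))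
    (\<lambda>s'. represents S s' \<and> ivars s' ''r'' = r \<and> best_among E (ivars s' ''best''))"
proof -
  \<comment> \<open>After \<open>i\<close> steps \<open>best\<close> is a minimizer among the
    candidates below \<open>i\<close>, or -1 if there are none. The value of \<open>r\<close> is
    carried along because the scan runs inside the loop of \<open>greedy\<close>.\<close>
  define I where "I i s \<longleftrightarrow> represents S s \<and> ivars s ''r'' = r \<and>
    best_among (E \<inter> {..<i}) (ivars s ''best'')" for i s
  have "runs (IAssign ''best'' (IConst (-1))) s (max_time (IAssign ''best'' (IConst (-1)))) (I 0)"
    by (rule runs_loop_free) (use s r in \<open>auto simp: I_def represents_set_ivar best_among_def\<close>)
  moreover have "runs (For ''v'' (compare_best b)) s (6 + n * (8 + max_time (compare_best b))) (I n)"
    if "I 0 s" for s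
  proof (rule runs_For)
    show "ivars s ''n'' = int n" using that unfolding I_def represents_def by simp
    show "I 0 (set_ivar ''v'' 0 s)" using that unfolding I_def by (simp add: represents_set_ivar)
    fix i s assume i: "i < n" "ivars s ''v'' = int i" "I i s"
    have rep: "represents S s" and best: "best_among (E \<inter> {..<i}) (ivars s ''best'')"
      and r: "ivars s ''r'' = r"
      using i(3) unfolding I_def by auto
    have deg: "rarrs s ''deg'' (int j) = in_degree T j" if "j < n" for j
      using rep that unfolding represents_def by simp
    have b: "bval b s \<longleftrightarrow> i \<in> E" using guard rep i by simp
    let ?s = "effect (compare_best b) s"
    have "best_among (E \<inter> {..<Suc i}) (ivars ?s ''best'')"
    proof (cases "ivars s ''best'' < 0")
      case True
      then show ?thesis using best b i(2)
        unfolding best_among_def compare_best_def by (auto simp: lessThan_Suc)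
    next
      case False
      then obtain j where j: "ivars s ''best'' = int j" "j \<in> E" "j < i"
        "\<forall>u\<in>E \<inter> {..<i}. in_degree T j \<le> in_degree T u"
        using best unfolding best_among_def by auto
      show ?thesis
      proof (cases "i \<in> E \<and> in_degree T i < in_degree T j")
        case True
        then have "ivars ?s ''best'' = int i"
          using j b i deg[of i] deg[of j] unfolding compare_best_def by simp
        then show ?thesis using True j(4) unfolding best_among_def
          by (intro disjI2 exI[of _ i]) (force simp: lessThan_Suc)
      next
        case False
        \<comment> \<open>A tie, or a vertex that is no candidate, leaves the earlier minimizer in
          place.\<close>
        then have "ivars ?s ''best'' = int j"
          using j b i deg[of i] deg[of j] unfolding compare_best_def by auto
        then show ?thesis using False j unfolding best_among_def
          by (intro disjI2 exI[of _ j]) (auto simp: lessThan_Suc)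
      qed
    qed
    moreover have "represents S ?s" "ivars ?s ''n'' = ivars s ''n''" "ivars ?s ''r'' = r"
      "ivars ?s ''v'' = int i"
      using rep r i(2) unfolding compare_best_def by (auto simp: represents_set_ivar)
    moreover have "ivars s ''n'' = int n" using rep unfolding represents_def by simp
    ultimately show "runs (compare_best b) s (max_time (compare_best b))
      (\<lambda>s'. ivars s' ''n'' = int n \<and> ivars s' ''v'' = int i \<and>
        I (Suc i) (set_ivar ''v'' (1 + int i) s'))"
      by (intro runs_loop_free) (auto simp: I_def represents_set_ivar compare_best_def)
  qed simp
  ultimately have "runs (find_best b) s
      (max_time (IAssign ''best'' (IConst (-1))) + (6 + n * (8 + max_time (compare_best b)))) (I n)"
    unfolding find_best_def by (rule runs_Seq)
  moreover have "E \<inter> {..<n} = E" using E verts_iff by auto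
  ultimately show ?thesis by (elim runs_mono) (auto simp: I_def)
qed

lemma represents_choose_best:
  assumes s: "represents S s" and v: "ivars s ''best'' = int v" "v \<in> verts T" "v \<notin> S"
  shows "represents (insert v S) (effect choose_best s)"
proof -
  have "finite S" using s finite_verts finite_subset unfolding represents_def by blast
  then show ?thesis
    using s v verts_iff[of v] color_count_insert[OF v(2,3)]
    unfolding represents_def choose_best_def by (auto simp: iput_def)
qed

text \<open>Serves both phases: \<open>E\<close> gives the candidates and \<open>J\<close> is the
  property kept by adding one of least in-degree.\<close>

lemma runs_greedy:
  assumes guard: "\<And>S s v. represents S s \<Longrightarrow> v < n \<Longrightarrow> ivars s ''v'' = int v \<Longrightarrow>
      bval b s \<longleftrightarrow> v \<in> E S"
    and E: "\<And>S. E S \<subseteq> verts T - S"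
    and J: "\<And>S v. J S \<Longrightarrow> v \<in> E S \<Longrightarrow> (\<And>u. u \<in> E S \<Longrightarrow> in_degree T v \<le> in_degree T u) \<Longrightarrow>
      J (insert v S)"
    and init: "represents S0 s" "J S0"
  shows "runs (greedy b) s
    (6 + n * (8 + (8 + n * (8 + max_time (compare_best b)) + max_time choose_best)))
    (\<lambda>s'. \<exists>S. represents S s' \<and> J S \<and> E S = {})"
proof -
  \<comment> \<open>Either every round so far has been productive, at least in number, or the
    candidates are exhausted and further rounds change nothing.\<close>
  define I where "I i s \<longleftrightarrow> (\<exists>S. represents S s \<and> J S \<and> (i \<le> card S \<or> E S = {}))" for i s
  have "runs (greedy b) s
    (6 + n * (8 + (8 + n * (8 + max_time (compare_best b)) + max_time choose_best))) (I n)"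
    unfolding greedy_def
  proof (rule runs_For)
    show "ivars s ''n'' = int n" using init unfolding represents_def by simp
    show "I 0 (set_ivar ''r'' 0 s)" using init unfolding I_def by (auto simp: represents_set_ivar)
    fix i s assume "ivars s ''r'' = int i" "I i s"
    then obtain S where S: "represents S s" "J S" "i \<le> card S \<or> E S = {}" "ivars s ''r'' = int i"
      unfolding I_def by auto
    have finS: "finite S" using S(1) finite_verts finite_subset unfolding represents_def by blast
    have "runs (find_best b) s (8 + n * (8 + max_time (compare_best b)))
      (\<lambda>s'. represents S s' \<and> ivars s' ''r'' = int i \<and> best_among (E S) (ivars s' ''best''))"
      by (rule runs_find_best) (use guard E[of S] S in auto)
    then show "runs (Seq (find_best b) choose_best) s
        (8 + n * (8 + max_time (compare_best b)) + max_time choose_best)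
      (\<lambda>s'. ivars s' ''n'' = int n \<and> ivars s' ''r'' = int i \<and>
        I (Suc i) (set_ivar ''r'' (1 + int i) s'))"
    proof (rule runs_Seq)
      fix s' assume s': "represents S s' \<and> ivars s' ''r'' = int i \<and> best_among (E S) (ivars s' ''best'')"
      have keep: "ivars (effect choose_best s') ''n'' = int n" "ivars (effect choose_best s') ''r'' = int i"
        using s' unfolding represents_def choose_best_def by (auto simp: iput_def)
      have "I (Suc i) (effect choose_best s')"
      proof (cases "E S = {}")
        case True
        then have "effect choose_best s' = s'"
          using s' unfolding best_among_def choose_best_def by auto
        with True s' S show ?thesis unfolding I_def by auto
      next
        case False
        then obtain v where v: "ivars s' ''best'' = int v" "v \<in> E S"
          "\<And>u. u \<in> E S \<Longrightarrow> in_degree T v \<le> in_degree T u"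
          using s' unfolding best_among_def by auto
        then have "represents (insert v S) (effect choose_best s')"
          using represents_choose_best s' E by blast
        moreover have "J (insert v S)" using J[OF S(2) v(2,3)] .
        moreover have "Suc i \<le> card (insert v S)" using S(3) False v(2) E[of S] finS by (auto simp: card_insert_if)
        ultimately show ?thesis unfolding I_def by blast
      qed
      then have "I (Suc i) (set_ivar ''r'' (1 + int i) (effect choose_best s'))"
        unfolding I_def by (simp add: represents_set_ivar)
      with keep show "runs choose_best s' (max_time choose_best)
        (\<lambda>s'. ivars s' ''n'' = int n \<and> ivars s' ''r'' = int i \<and>
          I (Suc i) (set_ivar ''r'' (1 + int i) s'))"
        by (intro runs_loop_free) (auto simp: choose_best_def)
    qed
  qed simp
  then show ?thesis
  proof (rule runs_mono)
    fix s' assume "I n s'"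
    then obtain S where S: "represents S s'" "J S" "n \<le> card S \<or> E S = {}" unfolding I_def by blast
    have "S \<subseteq> verts T" using S(1) unfolding represents_def by simp
    \<comment> \<open>After \<open>n\<close> productive rounds all vertices are chosen, and
      \<open>E S\<close> lies in the empty complement.\<close>
    then have "n \<le> card S \<Longrightarrow> S = verts T" using finite_verts card_seteq by blast
    with S(3) E[of S] have "E S = {}" by auto
    with S show "\<exists>S. represents S s' \<and> J S \<and> E S = {}" by blast
  qed simp
qed

section \<open>Computation of the in-degrees\<close>

lemma input_weight:
  assumes "u < n" "v < n"
  shows "rarrs (input_state T k \<alpha> \<beta>) ''w'' (int (u * n + v)) = (if u = v then 0 else weight T (u, v))"
proof -
  have "(u, v) \<in> arcs T \<longleftrightarrow> u \<noteq> v"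
    using tournament assms verts_iff unfolding weighted_colored_tournament_def by auto
  moreover have "nat (int (u * n + v)) div n = u" "nat (int (u * n + v)) mod n = v"
    using assms by (simp_all only: nat_int) auto
  ultimately show ?thesis unfolding input_state_def Let_def by simp
qed

lemma runs_in_degrees:
  "runs in_degrees (input_state T k \<alpha> \<beta>) (6 + n * (8 + (6 + n * (8 + max_time add_entry))))
     (represents {})"
proof -
  let ?s0 = "input_state T k \<alpha> \<beta>"
  define W where "W i j = rarrs ?s0 ''w'' (int (i * n + j))" for i j
  define frame where "frame s \<longleftrightarrow> iarrs s = iarrs ?s0 \<and> (\<forall>a. a \<noteq> ''deg'' \<longrightarrow> rarrs s a = rarrs ?s0 a) \<and>
    (\<forall>x. x \<notin> {''u'', ''v'', ''p''} \<longrightarrow> ivars s x = ivars ?s0 x)" for s :: state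
  define I where "I i s \<longleftrightarrow> frame s \<and> ivars s ''p'' = int (i * n) \<and>
    (\<forall>j<n. rarrs s ''deg'' (int j) = (\<Sum>u<i. W u j))" for i and s :: state
  \<comment> \<open>In the middle of row \<open>i\<close>, the columns before \<open>j\<close> have
    received their entry of this row and the others have not.\<close>
  define K where "K i j s \<longleftrightarrow> frame s \<and> ivars s ''u'' = int i \<and> ivars s ''p'' = int (i * n + j) \<and>
    (\<forall>l<n. rarrs s ''deg'' (int l) = (\<Sum>u<(if l < j then Suc i else i). W u l))" for i j and s :: state
  have n0: "ivars s ''n'' = int n" if "frame s" for s
    using that unfolding frame_def input_state_def Let_def by simp
  have "runs in_degrees ?s0 (6 + n * (8 + (6 + n * (8 + max_time add_entry)))) (I n)"
    unfolding in_degrees_def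
  proof (rule runs_For)
    show "ivars ?s0 ''n'' = int n" unfolding input_state_def Let_def by simp
    show "I 0 (set_ivar ''u'' 0 ?s0)" unfolding I_def frame_def
      by (simp add: input_state_def Let_def)
    fix i s assume i: "i < n" "ivars s ''u'' = int i" "I i s"
    have "runs (For ''v'' add_entry) s (6 + n * (8 + max_time add_entry)) (K i n)"
    proof (rule runs_For)
      show "ivars s ''n'' = int n" using i(3) n0 unfolding I_def by simp
      show "K i 0 (set_ivar ''v'' 0 s)" using i unfolding I_def K_def frame_def by simp
      fix j s assume j: "j < n" "ivars s ''v'' = int j" "K i j s"
      have fr: "frame s" using j(3) unfolding K_def by simp
      have w: "rarrs s ''w'' (ivars s ''p'') = W i j"
        using j(3) unfolding K_def frame_def W_def by simp
      let ?s = "effect add_entry s"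
      have "frame ?s"
        using fr unfolding frame_def add_entry_def by (simp add: rput_def)
      moreover have "ivars ?s ''v'' = int j" "ivars ?s ''u'' = int i" "ivars ?s ''p'' = int (i * n + Suc j)"
        using j unfolding K_def add_entry_def by (auto simp: rput_def)
      moreover have "rarrs ?s ''deg'' (int l) = (\<Sum>u<(if l < Suc j then Suc i else i). W u l)"
        if "l < n" for l
        using j that w unfolding K_def add_entry_def by (auto simp: rput_def less_Suc_eq)
      ultimately show "runs add_entry s (max_time add_entry)
        (\<lambda>s'. ivars s' ''n'' = int n \<and> ivars s' ''v'' = int j \<and>
           K i (Suc j) (set_ivar ''v'' (1 + int j) s'))"
        using n0[of ?s]
        by (intro runs_loop_free) (auto simp: K_def frame_def add_entry_def)
    qed simp
    \<comment> \<open>At the end of row \<open>i\<close> the pointer stands at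
      \<open>i * n + n\<close>, the start of the next row.\<close>
    then show "runs (For ''v'' add_entry) s (6 + n * (8 + max_time add_entry))
      (\<lambda>s'. ivars s' ''n'' = int n \<and> ivars s' ''u'' = int i \<and>
         I (Suc i) (set_ivar ''u'' (1 + int i) s'))"
      by (rule runs_mono) (use n0 in \<open>auto simp: K_def I_def frame_def algebra_simps\<close>)
  qed simp
  then show ?thesis
  proof (rule runs_mono)
    fix s assume s: "I n s"
    have deg: "(\<Sum>u<n. W u v) = in_degree T v" if "v < n" for v
    proof -
      \<comment> \<open>The zero diagonal of the input makes the full column sum equal to the
        in-degree.\<close>
      have "(\<Sum>u<n. W u v) = (\<Sum>u\<in>verts T. if u = v then 0 else weight T (u, v))"
        using that
        by (intro sum.cong[OF verts_lessThan[symmetric]])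
          (auto simp: W_def input_weight verts_iff simp del: of_nat_add of_nat_mult)
      also have "\<dots> = in_degree T v"
        unfolding in_degree_def using finite_verts by (intro sum.mono_neutral_cong_right) auto
      finally show ?thesis .
    qed
    \<comment> \<open>Zeroed memory encodes the empty set; \<open>color_range\<close> keeps the
      quota indices within the part of the arrays that holds input.\<close>
    show "represents {} s"
      using s deg color_range verts_iff
      unfolding represents_def I_def frame_def
      by (auto simp: input_state_def Let_def color_count_def)
  qed simp
qed

lemma runs_bipartition_program:
  "runs bipartition_program (input_state T k \<alpha> \<beta>)
    (6 + n * (8 + (6 + n * (8 + max_time add_entry))) +
      (6 + n * (8 + (8 + n * (8 + max_time (compare_best below_lower)) + max_time choose_best)) +
       (6 + n * (8 + (8 + n * (8 + max_time (compare_best below_upper)) + max_time choose_best)))))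
    (\<lambda>s. (\<exists>L. feasible T k \<alpha> \<beta> L) \<longrightarrow>
       optimal_colorful_bipartition T k \<alpha> \<beta> (output_bipartition T s))"
proof -
  let ?feas = "\<exists>L. feasible T k \<alpha> \<beta> L"
  \<comment> \<open>Both invariants are conditional on feasibility, because the time bound must also
    hold when no solution exists.\<close>
  let ?J1 = "\<lambda>S. ?feas \<longrightarrow> extendable S" and ?J2 = "\<lambda>S. ?feas \<longrightarrow> extendable S \<and> lower_filled S"
  have init: "?J1 {}" using optimal_exists unfolding extendable_def by blast
  show ?thesis
    unfolding bipartition_program_def
  proof (rule runs_Seq[OF runs_in_degrees runs_Seq])
    fix s assume s: "represents {} s"
    show "runs (greedy below_lower) s
      (6 + n * (8 + (8 + n * (8 + max_time (compare_best below_lower)) + max_time choose_best)))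
      (\<lambda>s'. \<exists>S. represents S s' \<and> ?J1 S \<and> lower_candidates S = {})"
    proof (rule runs_greedy[where J = ?J1 and E = lower_candidates, OF below_lower_iff _ _ s init])
      show "lower_candidates S \<subseteq> verts T - S" for S unfolding lower_candidates_def by auto
      show "?J1 (insert v S)" if "?J1 S" "v \<in> lower_candidates S"
        "\<And>u. u \<in> lower_candidates S \<Longrightarrow> in_degree T v \<le> in_degree T u" for S v
        using that extendable_lower_step by blast
    qed
  next
    fix s assume "\<exists>S. represents S s \<and> ?J1 S \<and> lower_candidates S = {}"
    then obtain S where S: "represents S s" "?J2 S"
      using lower_filled_if_no_candidates by blast
    have "runs (greedy below_upper) s
      (6 + n * (8 + (8 + n * (8 + max_time (compare_best below_upper)) + max_time choose_best)))
      (\<lambda>s'. \<exists>S. represents S s' \<and> ?J2 S \<and> upper_candidates S = {})"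
    proof (rule runs_greedy[where J = ?J2 and E = upper_candidates, OF below_upper_iff _ _ S])
      show "upper_candidates S \<subseteq> verts T - S" for S unfolding upper_candidates_def by auto
      fix S v assume *: "?J2 S" "v \<in> upper_candidates S"
        "\<And>u. u \<in> upper_candidates S \<Longrightarrow> in_degree T v \<le> in_degree T u"
      \<comment> \<open>Color counts only grow, so the second phase keeps what the first has
        achieved.\<close>
      have "lower_filled S \<Longrightarrow> lower_filled (insert v S)"
        unfolding lower_filled_def using color_count_mono[of S "insert v S"]
        by (meson of_nat_mono order_trans subset_insertI)
      with * show "?J2 (insert v S)" using extendable_upper_step by blast
    qed
    then show "runs (greedy below_upper) s
      (6 + n * (8 + (8 + n * (8 + max_time (compare_best below_upper)) + max_time choose_best)))
      (\<lambda>s. ?feas \<longrightarrow> optimal_colorful_bipartition T k \<alpha> \<beta> (output_bipartition T s))"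
    proof (rule runs_mono, goal_cases)
      case (2 s)
      then obtain S where S: "represents S s" "?feas \<longrightarrow> optimal S"
        using optimal_if_no_candidates by blast
      have "S \<subseteq> verts T" "\<And>v. v \<in> verts T \<Longrightarrow> iarrs s ''L'' (int v) = of_bool (v \<in> S)"
        using S(1) verts_iff unfolding represents_def by auto
      then have "output_bipartition T s = (S, verts T - S)"
        unfolding output_bipartition_def by auto
      with S(2) show ?case
        unfolding optimal_colorful_bipartition_def optimal_def by simp
    qed simp
  qed
qed

section \<open>The time bound in terms of the arcs\<close>

lemma card_arcs: "real (card (arcs T)) = real n * (real n - 1)"
proof -
  have "arcs T = verts T \<times> verts T - (\<lambda>v. (v, v)) ` verts T"
    using tournament unfolding weighted_colored_tournament_def by auto
  then have "card (arcs T) = n * n - n"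
    using finite_verts by (simp add: card_Diff_subset card_cartesian_product card_image inj_on_def image_subset_iff)
  then show ?thesis by (simp add: algebra_simps)
qed

end

text \<open>From \<open>(n - 1)^2 \<ge> 0\<close>, both \<open>n\<close> and \<open>n * n\<close>
  are at most \<open>2 * (n * (n - 1) + 1)\<close>, which explains the factor 2. The added 1 covers
  \<open>n \<le> 1\<close>, where there are no arcs. The logarithmic term is only bounded below by
  0.\<close>

lemma quadratic_le_arc_bound:
  fixes a b c n :: nat
  shows "real (a * (n * n) + b * n + c) \<le>
    real (2 * (a + b) + c) * (real n * (real n - 1) + real n * log 2 (real n) + 1)"
proof -
  have log: "0 \<le> real n * log 2 (real n)" by (cases "n = 0") auto
  have nn: "real n \<le> real n * real n" by (cases n) (auto simp: algebra_simps)
  define m where "m = real n * (real n - 1)"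
  have m0: "0 \<le> m" using nn unfolding m_def by (simp add: algebra_simps)
  have "0 \<le> (real n - 1)\<^sup>2" by simp
  then have sq: "real n * real n \<le> 2 * (m + 1)"
    unfolding m_def by (simp add: power2_eq_square algebra_simps)
  have "real (a * (n * n) + b * n + c) \<le> real a * (2 * (m + 1)) + real b * (2 * (m + 1)) + real c * (m + 1)"
    unfolding of_nat_add of_nat_mult using sq order_trans[OF nn sq] m0
    by (intro add_mono mult_left_mono) (simp_all add: mult_le_cancel_left1)
  also have "\<dots> = real (2 * (a + b) + c) * (m + 1)" by (simp add: algebra_simps)
  also have "\<dots> \<le> real (2 * (a + b) + c) * (m + real n * log 2 (real n) + 1)"
    using log by (intro mult_left_mono) auto
  finally show ?thesis unfolding m_def .
qed

theorem theorem1: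
  "\<exists>(P :: com) (C :: real). \<forall>(T :: nat colored_tournament) (k :: int) (\<alpha> :: nat \<Rightarrow> real) (\<beta> :: nat \<Rightarrow> real).
     weighted_colored_tournament T \<longrightarrow>
     verts T = {..<card (verts T)} \<longrightarrow>
     probability_constraints T \<longrightarrow>
     triangle_constraints T \<longrightarrow>
     (\<forall>i \<in> {1..num_colors T}. \<alpha> i \<in> {0..1} \<and> \<beta> i \<in> {0..1}) \<longrightarrow>
     (\<exists>t s. exec P (input_state T k \<alpha> \<beta>) t s \<and>
        real t \<le> C * (real (card (arcs T)) + real (card (verts T)) * log 2 (real (card (verts T))) + 1) \<and>
        ((\<exists>L. feasible T k \<alpha> \<beta> L) \<longrightarrow>
           optimal_colorful_bipartition T k \<alpha> \<beta> (output_bipartition T s)))"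
proof -
  \<comment> \<open>These are the coefficients of the expanded bound: three double loops give
    \<open>24 = 3 * 8\<close> for \<open>n * n\<close>, \<open>46 = 14 + 16 + 16\<close> for
    \<open>n\<close>, and the constant \<open>18 = 3 * 6\<close>.\<close>
  define a where "a = 24 + max_time add_entry + max_time (compare_best below_lower) +
    max_time (compare_best below_upper)"
  define b where "b = 46 + 2 * max_time choose_best"
  show ?thesis
  proof (rule exI[of _ bipartition_program], rule exI[of _ "real (2 * (a + b) + 18)"],
      intro allI impI, goal_cases)
    case (1 T k \<alpha> \<beta>)
    then interpret bipartition_instance T k \<alpha> \<beta> by unfold_locales
    let ?opt = "\<lambda>s. (\<exists>L. feasible T k \<alpha> \<beta> L) \<longrightarrow>
      optimal_colorful_bipartition T k \<alpha> \<beta> (output_bipartition T s)"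
    have "runs bipartition_program (input_state T k \<alpha> \<beta>) (a * (n * n) + b * n + 18) ?opt"
      by (rule runs_mono[OF runs_bipartition_program]) (auto simp: a_def b_def algebra_simps)
    then obtain t s where ts: "exec bipartition_program (input_state T k \<alpha> \<beta>) t s"
      "t \<le> a * (n * n) + b * n + 18" "?opt s"
      unfolding runs_def by blast
    have "real t \<le> real (a * (n * n) + b * n + 18)" using ts(2) by (rule of_nat_mono)
    also have "\<dots> \<le> real (2 * (a + b) + 18) * (real (card (arcs T)) + real n * log 2 (real n) + 1)"
      unfolding card_arcs by (rule quadratic_le_arc_bound)
    finally show ?case using ts(1,3) by blast
  qed
qed

end
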